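(* Inflection curves of rational vector fields are precisely the real dessins associated with exact rational differentials. That is, a subset $\Gamma\subset\mathbb{CP}^1$ is of the form $\Gamma=(R')^{-1}(\mathbb{RP}^1)$ for some nonconstant rational function $R$ if and only if $\Gamma=f^{-1}(\mathbb{RP}^1)$ for some rational function $f$ such that all residues of the meromorphic differential $f(z)\,dz$ at finite poles vanish.
   Context: For a rational vector field $-R(z)\frac{\partial}{\partial z}$ with $R$ a nonconstant rational function, the inflection curve is $\mathfrak{I}_R=(R')^{-1}(\mathbb{RP}^1)$, where $R'$ is viewed as a map $\mathbb{CP}^1\to\mathbb{CP}^1$ and $\mathbb{RP}^1=\mathbb{R}\cup\{\infty\}\subset\mathbb{CP}^1$. For a rational map $f$, its real dessin is $\Gamma_f=f^{-1}(\mathbb{RP}^1)\subset\mathbb{CP}^1$. An exact rational differential is a rational differential $f(z)\,dz$ with zero residues. *)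

theory Defs
  imports
    "HOL-Computational_Algebra.Computational_Algebra"
    "HOL-Computational_Algebra.Field_as_Ring"
    "HOL-Complex_Analysis.Complex_Analysis"
begin

text \<open>
  Points of the complex projective line: \<^term>\<open>Some z\<close> is the finite point \<^term>\<open>z\<close>, and
  \<^term>\<open>None\<close> is infinity, as in \<^const>\<open>Alexandroff_compactification\<close>.
\<close>

type_synonym CP1 = "complex option"

definition RP1 :: "CP1 set" where
  "RP1 = insert None (Some ` \<real>)"

type_synonym rat_fun = "complex poly fract"

text \<open>
  Numerator and denominator in lowest terms; the denominator is nonzero (and monic).
\<close>

definition rat_num :: "rat_fun \<Rightarrow> complex poly" where
  "rat_num f = fst (quot_of_fract f)"

definition rat_den :: "rat_fun \<Rightarrow> complex poly" where
  "rat_den f = snd (quot_of_fract f)"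

definition nonconstant :: "rat_fun \<Rightarrow> bool" where
  "nonconstant f \<longleftrightarrow> (\<forall>c. f \<noteq> to_fract [:c:])"

text \<open>
  The function on the finite plane. At a pole it has the junk value \<open>0\<close>, which affects neither
  \<^const>\<open>is_pole\<close> nor \<^const>\<open>residue\<close>, as both depend only on a punctured neighbourhood.
\<close>

definition rat_eval :: "rat_fun \<Rightarrow> complex \<Rightarrow> complex" where
  "rat_eval f z = poly (rat_num f) z / poly (rat_den f) z"

text \<open>
  The holomorphic self-map of the projective line. With \<open>d\<close> the degree of the denominator, the
  value at infinity is the limit of \<open>p z / q z\<close>: it is infinite if the numerator has degree
  larger than \<open>d\<close>, and otherwise the quotient of the coefficients of \<open>z ^ d\<close>
  (the upper one being zero if the numerator has degree smaller than \<open>d\<close>).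
\<close>

fun rat_map :: "rat_fun \<Rightarrow> CP1 \<Rightarrow> CP1" where
  "rat_map f (Some z) = (if poly (rat_den f) z = 0 then None else Some (rat_eval f z))"
| "rat_map f None =
     (if degree (rat_num f) > degree (rat_den f) then None
      else Some (coeff (rat_num f) (degree (rat_den f)) / lead_coeff (rat_den f)))"

definition rat_deriv :: "rat_fun \<Rightarrow> rat_fun" where
  "rat_deriv f =
     Fract (pderiv (rat_num f) * rat_den f - rat_num f * pderiv (rat_den f)) ((rat_den f)\<^sup>2)"

text \<open>The inflection curve of the vector field \<open>- R(z) d/dz\<close>.\<close>

definition inflection_curve :: "rat_fun \<Rightarrow> CP1 set" where
  "inflection_curve R = rat_map (rat_deriv R) -` RP1"

definition real_dessin :: "rat_fun \<Rightarrow> CP1 set" where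
  "real_dessin f = rat_map f -` RP1"

text \<open>
  Exactness of the differential \<open>f(z) dz\<close>. Only finite poles are considered: since the residues
  of a rational differential sum to zero, the residue at infinity then vanishes as well.
\<close>

definition exact_differential :: "rat_fun \<Rightarrow> bool" where
  "exact_differential f \<longleftrightarrow> (\<forall>z. is_pole (rat_eval f) z \<longrightarrow> residue (rat_eval f) z = 0)"

end

theory Submission
  imports Defs
begin

text \<open>
  A derivative has zero residues because it integrates to zero along every closed path. Conversely,
  Hermite reduction lowers a pole of order at least two by subtracting the derivative of a multiple
  of a negative power of \<open>z - a\<close>; as residues are preserved, no simple pole can remain, and what is
  left in the end is a polynomial, which has a primitive.
\<close>

section \<open>Lowest terms and evaluation of fractions\<close>

lemma rat_den_nonzero [simp]: "rat_den f \<noteq> 0"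
  by (simp add: rat_den_def)

lemma Fract_rat_num_rat_den: "Fract (rat_num f) (rat_den f) = f"
  by (simp add: rat_num_def rat_den_def)

lemma coprime_rat_num_rat_den: "coprime (rat_num f) (rat_den f)"
  by (simp add: rat_num_def rat_den_def coprime_quot_of_fract)

lemma poly_rat_num_nonzero:
  assumes "poly (rat_den f) z = 0"
  shows "poly (rat_num f) z \<noteq> 0"
  using coprime_poly_0[OF coprime_rat_num_rat_den] assms by blast

lemma rat_num_mult_eq:
  assumes "b \<noteq> 0"
  shows "rat_num (Fract a b) * b = a * rat_den (Fract a b)"
  using Fract_rat_num_rat_den[of "Fract a b"] assms by (simp add: eq_fract)

lemma rat_den_Fract_dvd:
  assumes "b \<noteq> 0"
  shows "rat_den (Fract a b) dvd b"
proof -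
  have "rat_den (Fract a b) dvd rat_num (Fract a b) * b"
    by (simp add: rat_num_mult_eq[OF assms])
  then show ?thesis
    using coprime_rat_num_rat_den by (metis coprime_commute coprime_dvd_mult_right_iff)
qed

text \<open>The fraction need not be reduced: the reduced denominator divides \<open>b\<close>, so
  it does not vanish at \<open>z\<close> either, and the cross-multiplied identity can be divided.
  At a common zero of \<open>a\<close> and \<open>b\<close> the right-hand side would be the default
  value 0.\<close>

lemma rat_eval_Fract:
  assumes "poly b z \<noteq> 0"
  shows "rat_eval (Fract a b) z = poly a z / poly b z"
proof -
  have "b \<noteq> 0" using assms by auto
  have "poly (rat_den (Fract a b)) z \<noteq> 0"
    using rat_den_Fract_dvd[OF \<open>b \<noteq> 0\<close>, of a] assms by (metis dvd_trans poly_eq_0_iff_dvd)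
  moreover have "poly (rat_num (Fract a b)) z * poly b z = poly a z * poly (rat_den (Fract a b)) z"
    using rat_num_mult_eq[OF \<open>b \<noteq> 0\<close>, of a] by (metis poly_mult)
  ultimately show ?thesis
    using assms by (simp add: rat_eval_def field_simps)
qed

section \<open>Rational functions on punctured neighbourhoods\<close>

lemma eventually_poly_nonzero:
  fixes b :: "complex poly"
  assumes "b \<noteq> 0"
  shows "eventually (\<lambda>w. poly b w \<noteq> 0) (at z)"
proof -
  \<comment> \<open>Only the roots other than \<open>z\<close> are removed, so that the set stays a
    neighbourhood of \<open>z\<close> even if \<open>z\<close> is a root.\<close>
  have "open (- ({w. poly b w = 0} - {z}))"
    by (intro open_Compl finite_imp_closed finite_Diff poly_roots_finite assms)
  then show ?thesis
    unfolding eventually_at_topological by (auto intro!: exI[of _ "- ({w. poly b w = 0} - {z})"])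
qed

lemma holomorphic_on_punctured_nhd:
  obtains S where "open S" "z \<in> S" "rat_eval f holomorphic_on S - {z}"
proof -
  obtain S where S: "open S" "z \<in> S" "\<And>w. w \<in> S \<Longrightarrow> w \<noteq> z \<Longrightarrow> poly (rat_den f) w \<noteq> 0"
    using eventually_poly_nonzero[OF rat_den_nonzero, of f z]
    unfolding eventually_at_topological by blast
  have "rat_eval f holomorphic_on S - {z}"
    unfolding rat_eval_def [abs_def] using S(3) by (auto intro!: holomorphic_intros)
  with S that show thesis by blast
qed

text \<open>At a pole the default values can break the pointwise identity, but it holds wherever
  both denominators are nonzero, hence on a punctured neighbourhood, and residues see no more than
  that.\<close>

lemma residue_rat_eval_diff:
  "residue (rat_eval (f - g)) z = residue (rat_eval f) z - residue (rat_eval g) z"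
proof -
  obtain S where S: "open S" "z \<in> S" "rat_eval f holomorphic_on S - {z}"
    by (rule holomorphic_on_punctured_nhd)
  obtain T where T: "open T" "z \<in> T" "rat_eval g holomorphic_on T - {z}"
    by (rule holomorphic_on_punctured_nhd)
  have eq: "f - g = Fract (rat_num f * rat_den g - rat_num g * rat_den f) (rat_den f * rat_den g)"
    by (metis Fract_rat_num_rat_den diff_fract rat_den_nonzero)
  have "eventually (\<lambda>w. poly (rat_den f * rat_den g) w \<noteq> 0) (at z)"
    by (rule eventually_poly_nonzero) simp
  then have "eventually (\<lambda>w. rat_eval (f - g) w = rat_eval f w - rat_eval g w) (at z)"
  proof (rule eventually_mono)
    fix w assume w: "poly (rat_den f * rat_den g) w \<noteq> 0"
    show "rat_eval (f - g) w = rat_eval f w - rat_eval g w"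
      unfolding eq rat_eval_Fract[OF w] using w by (simp add: rat_eval_def field_simps)
  qed
  then have "residue (rat_eval (f - g)) z = residue (\<lambda>w. rat_eval f w - rat_eval g w) z"
    by (rule residue_cong) simp
  also have "\<dots> = residue (rat_eval f) z - residue (rat_eval g) z"
    using S(1,2) T(1,2)
    by (intro residue_diff[of "S \<inter> T"] holomorphic_on_subset[OF S(3)]
        holomorphic_on_subset[OF T(3)]) auto
  finally show ?thesis .
qed

section \<open>The formal derivative\<close>

lemma rat_deriv_Fract:
  assumes "b \<noteq> 0"
  shows "rat_deriv (Fract a b) = Fract (pderiv a * b - a * pderiv b) (b\<^sup>2)"
proof -
  define n d where "n = rat_num (Fract a b)" and "d = rat_den (Fract a b)"
  have eq: "n * b = a * d" and "d \<noteq> 0"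
    using rat_num_mult_eq[OF assms] by (simp_all add: n_def d_def)
  \<comment> \<open>The quotient rule does not depend on the representation: the cross-multiplied
    identity and its derivative together imply equality of the two quotient-rule fractions.\<close>
  have "pderiv (n * b) = pderiv (a * d)"
    by (simp add: eq)
  then have eq': "n * pderiv b + b * pderiv n = a * pderiv d + d * pderiv a"
    by (simp add: pderiv_mult)
  have "(pderiv n * d - n * pderiv d) * b\<^sup>2 = (pderiv a * b - a * pderiv b) * d\<^sup>2"
    using eq eq' by algebra
  then show ?thesis
    using assms \<open>d \<noteq> 0\<close>
    by (simp add: rat_deriv_def eq_fract flip: n_def d_def)
qed

lemma rat_deriv_add: "rat_deriv (f + g) = rat_deriv f + rat_deriv g"
proof (cases f, cases g)
  fix a b c d :: "complex poly"
  assume fg: "f = Fract a b" "b \<noteq> 0" "g = Fract c d" "d \<noteq> 0"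
  then have "rat_deriv (f + g) =
      Fract (pderiv (a * d + c * b) * (b * d) - (a * d + c * b) * pderiv (b * d)) ((b * d)\<^sup>2)"
    by (simp add: rat_deriv_Fract)
  \<comment> \<open>Regrouped into the shape that adding the two quotient-rule fractions
    produces.\<close>
  also have "\<dots> = Fract ((pderiv a * b - a * pderiv b) * d\<^sup>2 + (pderiv c * d - c * pderiv d) * b\<^sup>2)
      (b\<^sup>2 * d\<^sup>2)"
    by (rule arg_cong2[where f = Fract])
       (simp_all add: pderiv_mult pderiv_add algebra_simps power2_eq_square)
  also have "\<dots> = rat_deriv f + rat_deriv g"
    using fg by (simp add: rat_deriv_Fract)
  finally show ?thesis .
qed

text \<open>This links the formal derivative to the complex one. The quotient-rule fraction may be
  unreduced, but its denominator is nonzero at \<open>z\<close>, so \<open>rat_eval_Fract\<close>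
  applies.\<close>

lemma has_field_derivative_rat_eval:
  assumes "poly (rat_den f) z \<noteq> 0"
  shows "(rat_eval f has_field_derivative rat_eval (rat_deriv f) z) (at z)"
proof -
  have "(rat_eval f has_field_derivative
      poly (pderiv (rat_num f) * rat_den f - rat_num f * pderiv (rat_den f)) z / poly ((rat_den f)\<^sup>2) z) (at z)"
    unfolding rat_eval_def [abs_def] using assms
    by (auto intro!: derivative_eq_intros simp: power2_eq_square)
  then show ?thesis
    unfolding rat_deriv_def using assms by (subst rat_eval_Fract) auto
qed

section \<open>Residues of derivatives and exactness\<close>

lemma residue_rat_deriv: "residue (rat_eval (rat_deriv f)) z = 0"
proof -
  obtain S where S: "open S" "z \<in> S" "rat_eval (rat_deriv f) holomorphic_on S - {z}"
    by (rule holomorphic_on_punctured_nhd)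
  obtain T where T: "open T" "z \<in> T" "\<And>w. w \<in> T \<Longrightarrow> w \<noteq> z \<Longrightarrow> poly (rat_den f) w \<noteq> 0"
    using eventually_poly_nonzero[OF rat_den_nonzero, of f z]
    unfolding eventually_at_topological by blast
  \<comment> \<open>The circle must lie in \<open>S\<close>, where its integral computes the
    residue, and in \<open>T - {z}\<close>, where \<open>rat_eval f\<close> is a primitive even if
    \<open>z\<close> is a pole of \<open>f\<close>.\<close>
  obtain r where r: "r > 0" "cball z r \<subseteq> S \<inter> T"
    using S T by (metis open_contains_cball IntI open_Int)
  have "(rat_eval (rat_deriv f) has_contour_integral 2 * pi * \<i> * residue (rat_eval (rat_deriv f)) z)
      (circlepath z r)"
    using S(1,2) r holomorphic_on_subset[OF S(3)] by (intro base_residue[of S]) auto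
  moreover have "(rat_eval (rat_deriv f) has_contour_integral 0) (circlepath z r)"
  proof (rule Cauchy_theorem_primitive[where S = "T - {z}"])
    show "(rat_eval f has_field_derivative rat_eval (rat_deriv f) w) (at w within T - {z})"
      if "w \<in> T - {z}" for w
      using that T(3) has_field_derivative_rat_eval has_field_derivative_at_within by blast
    have "sphere z r \<subseteq> T - {z}"
      using r by (auto simp: subset_iff)
    then show "path_image (circlepath z r) \<subseteq> T - {z}"
      using r by simp
  qed auto
  ultimately show ?thesis
    using has_contour_integral_unique by fastforce
qed

lemma is_pole_rat_eval:
  assumes "poly (rat_den f) z = 0"
  shows "is_pole (rat_eval f) z"
  unfolding rat_eval_def [abs_def]
proof (rule is_pole_divide)
  show "isCont (poly (rat_num f)) z" by simp
  show "filterlim (poly (rat_den f)) (at 0) (at z)"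
    using eventually_poly_nonzero[OF rat_den_nonzero, of f z] assms
    by (simp add: filterlim_at) (metis isContD poly_isCont)
  show "poly (rat_num f) z \<noteq> 0" by (rule poly_rat_num_nonzero[OF assms])
qed

text \<open>Off the poles the function is holomorphic and its residue is zero anyway. Without the
  pole condition the property passes directly to differences, as the Hermite reduction
  requires.\<close>

lemma exact_differential_iff: "exact_differential f \<longleftrightarrow> (\<forall>z. residue (rat_eval f) z = 0)"
proof (intro iffI allI)
  fix z assume exact: "exact_differential f"
  show "residue (rat_eval f) z = 0"
  proof (cases "poly (rat_den f) z = 0")
    case True
    then show ?thesis using exact is_pole_rat_eval by (simp add: exact_differential_def)
  next
    case False
    have "open {w. poly (rat_den f) w \<noteq> 0}"
      by (intro open_Collect_neq continuous_intros)
    moreover have "rat_eval f holomorphic_on {w. poly (rat_den f) w \<noteq> 0}"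
      unfolding rat_eval_def [abs_def] by (auto intro!: holomorphic_intros)
    ultimately show ?thesis using False by (intro residue_holo) auto
  qed
qed (simp add: exact_differential_def)

section \<open>Primitives by Hermite reduction\<close>

lemma pderiv_surj:
  fixes p :: "'a :: field_char_0 poly"
  shows "\<exists>q. pderiv q = p"
proof
  \<comment> \<open>Integration term by term; the divisors \<open>of_nat (Suc i)\<close> are nonzero
    in characteristic 0.\<close>
  show "pderiv (\<Sum>i\<le>degree p. monom (coeff p i / of_nat (Suc i)) (Suc i)) = p"
    by (simp add: higher_pderiv_sum[of 1, simplified] pderiv_monom poly_as_sum_of_monoms del: of_nat_Suc)
qed

lemma rat_deriv_inverse_power:
  "rat_deriv (Fract [:c:] ([:- a, 1:] ^ Suc m)) =
     Fract [:- (of_nat (Suc m) * c):] ([:- a, 1:] ^ Suc (Suc m))"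
proof -
  define u where "u = [:- a, 1:]"
  have "u \<noteq> 0" by (simp add: u_def)
  have "pderiv (u ^ Suc m) = smult (of_nat (Suc m)) (u ^ m)"
    unfolding pderiv_power_Suc by (simp add: u_def pderiv_pCons)
  \<comment> \<open>Squaring the denominator gives exponent \<open>2 * m + 2\<close>; the factor
    \<open>u ^ m\<close> is split off because it also occurs in the numerator.\<close>
  then have "rat_deriv (Fract [:c:] (u ^ Suc m)) =
      Fract (u ^ m * [:- (of_nat (Suc m) * c):]) (u ^ m * u ^ Suc (Suc m))"
    using \<open>u \<noteq> 0\<close>
    by (subst rat_deriv_Fract)
       (auto simp: power2_eq_square mult_ac intro!: arg_cong2[where f = Fract])
  also have "\<dots> = Fract [:- (of_nat (Suc m) * c):] (u ^ Suc (Suc m))"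
    using \<open>u \<noteq> 0\<close> by (intro mult_fract_cancel) simp
  finally show ?thesis by (simp add: u_def)
qed

text \<open>The induction is on the degree of the reduced denominator: each step lowers the order of
  one pole by at least one and leaves all residues zero.\<close>

lemma zero_residues_imp_rat_deriv:
  assumes "\<And>z. residue (rat_eval f) z = 0"
  shows "\<exists>R. rat_deriv R = f"
  using assms
proof (induction "degree (rat_den f)" arbitrary: f rule: less_induct)
  case less
  show ?case
  proof (cases "degree (rat_den f) = 0")
    case True
    then obtain c where c: "rat_den f = [:c:]" "c \<noteq> 0"
      by (metis degree_eq_zeroE pCons_0_0 rat_den_nonzero)
    obtain q where q: "pderiv q = smult (inverse c) (rat_num f)"
      using pderiv_surj by blast
    have "rat_deriv (Fract q 1) = Fract (rat_num f) [:c:]"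
      using c q by (simp add: rat_deriv_Fract eq_fract)
    then show ?thesis
      using Fract_rat_num_rat_den[of f] c by auto
  next
    case False
    then obtain a where a: "poly (rat_den f) a = 0"
      using Fundamental_Theorem_Algebra.fundamental_theorem_of_algebra[of "rat_den f"]
      by (auto simp: constant_degree)
    define u where "u = [:- a, 1:]"
    define n where "n = rat_num f"
    obtain g where g: "rat_den f = u ^ order a (rat_den f) * g" "\<not> u dvd g"
      using order_decomp[OF rat_den_nonzero, of f a] unfolding u_def by blast
    have ga: "poly g a \<noteq> 0"
      using g(2) by (simp add: u_def poly_eq_0_iff_dvd)
    then have "g \<noteq> 0" by auto
    have "u \<noteq> 0" by (simp add: u_def)
    obtain m where m: "order a (rat_den f) = Suc m"
      using a by (metis not0_implies_Suc order_root rat_den_nonzero)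
    have den: "rat_den f = u ^ Suc m * g"
      using g(1) unfolding m .
    have f_eq: "f = Fract n (u ^ Suc m * g)"
      using Fract_rat_num_rat_den[of f] unfolding den n_def by (rule sym)
    \<comment> \<open>For \<open>m = 0\<close> the pole is simple, with residue
      \<open>poly n a / poly g a\<close>. This is nonzero, since the reduced numerator does not
      vanish at \<open>a\<close>.\<close>
    have "m \<noteq> 0"
    proof
      assume "m = 0"
      have "residue (rat_eval f) a = residue (\<lambda>w. (poly n w / poly g w) / (w - a)) a"
        unfolding rat_eval_def den n_def u_def \<open>m = 0\<close> by (simp add: algebra_simps)
      also have "\<dots> = poly n a / poly g a"
      proof (rule residue_simple)
        show "open {w. poly g w \<noteq> 0}"
          by (intro open_Collect_neq continuous_intros)
        show "(\<lambda>w. poly n w / poly g w) holomorphic_on {w. poly g w \<noteq> 0}"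
          by (auto intro!: holomorphic_intros)
      qed (use ga in auto)
      finally show False
        using less.prems[of a] ga poly_rat_num_nonzero[OF a] by (simp add: n_def)
    qed
    \<comment> \<open>The pole has order \<open>Suc m\<close>, so the term whose derivative cancels
      it has denominator \<open>u ^ m\<close>; writing \<open>m\<close> as a successor fits
      \<open>rat_deriv_inverse_power\<close>.\<close>
    then obtain k where k: "m = Suc k"
      by (meson not0_implies_Suc)
    \<comment> \<open>The choice of \<open>c\<close> makes the numerator of \<open>f - rat_deriv G\<close> vanish at \<open>a\<close>.\<close>
    define c where "c = - (poly n a / (of_nat m * poly g a))"
    define G where "G = Fract [:c:] (u ^ m)"
    have "poly (n + [:of_nat m * c:] * g) a = 0"
      using ga \<open>m \<noteq> 0\<close> by (simp add: c_def)
    then obtain p where p: "n + [:of_nat m * c:] * g = u * p"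
      unfolding u_def poly_eq_0_iff_dvd by (elim dvdE)
    have "rat_deriv G = Fract [:- (of_nat m * c):] (u ^ Suc m)"
      unfolding G_def u_def k by (rule rat_deriv_inverse_power)
    also have "\<dots> = Fract (g * [:- (of_nat m * c):]) (g * u ^ Suc m)"
      using \<open>g \<noteq> 0\<close> by (rule mult_fract_cancel [symmetric])
    finally have G': "rat_deriv G = Fract (g * [:- (of_nat m * c):]) (u ^ Suc m * g)"
      by (simp only: mult.commute)
    have nz: "u ^ Suc m * g \<noteq> 0" "u ^ m * g \<noteq> 0"
      using \<open>u \<noteq> 0\<close> \<open>g \<noteq> 0\<close> by auto
    have "f - rat_deriv G = Fract (n - g * [:- (of_nat m * c):]) (u ^ Suc m * g)"
      unfolding f_eq G' using nz(1) by (simp add: eq_fract) (simp add: algebra_simps)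
    \<comment> \<open>The numerator vanishes at \<open>a\<close>, so one factor \<open>u\<close>
      cancels.\<close>
    also have "n - g * [:- (of_nat m * c):] = u * p"
      using p by simp
    also have "Fract (u * p) (u ^ Suc m * g) = Fract p (u ^ m * g)"
      using mult_fract_cancel[OF \<open>u \<noteq> 0\<close>, of p "u ^ m * g"] by (simp add: mult.assoc)
    finally have h: "f - rat_deriv G = Fract p (u ^ m * g)" .
    \<comment> \<open>Further cancellation is possible, which can only lower the degree, so a bound
      suffices.\<close>
    have "degree (rat_den (f - rat_deriv G)) \<le> degree (u ^ m * g)"
      unfolding h using nz(2) by (intro dvd_imp_degree_le rat_den_Fract_dvd)
    also have "\<dots> < degree (rat_den f)"
    proof -
      have "rat_den f = u * (u ^ m * g)"
        by (simp add: den mult.assoc)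
      then show ?thesis
        using nz(2) \<open>u \<noteq> 0\<close> by (simp add: degree_mult_eq) (simp add: u_def)
    qed
    finally obtain R where "rat_deriv R = f - rat_deriv G"
      using less.hyps[of "f - rat_deriv G"] less.prems
      by (auto simp: residue_rat_eval_diff residue_rat_deriv)
    then have "rat_deriv (R + G) = f"
      by (simp add: rat_deriv_add)
    then show ?thesis ..
  qed
qed

lemma exact_differential_iff_rat_deriv: "exact_differential f \<longleftrightarrow> (\<exists>R. rat_deriv R = f)"
  using zero_residues_imp_rat_deriv residue_rat_deriv unfolding exact_differential_iff by blast

text \<open>Together with \<open>real_dessin_1\<close> this allows a constant primitive to be
  replaced by a nonconstant one.\<close>

lemma real_dessin_0: "real_dessin 0 = UNIV"
proof -
  have "rat_map 0 x \<in> RP1" for x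
    by (cases x) (auto simp: rat_num_def rat_den_def rat_eval_def RP1_def)
  then show ?thesis by (auto simp: real_dessin_def)
qed

lemma real_dessin_1: "real_dessin 1 = UNIV"
proof -
  have "rat_map 1 x \<in> RP1" for x
    by (cases x) (auto simp: rat_num_def rat_den_def rat_eval_def RP1_def)
  then show ?thesis by (auto simp: real_dessin_def)
qed

lemma rat_deriv_to_fract: "rat_deriv (to_fract p) = to_fract (pderiv p)"
  by (simp add: to_fract_def rat_deriv_Fract)

theorem corollary7p2:
  fixes \<Gamma> :: "CP1 set"
  shows "(\<exists>R. nonconstant R \<and> \<Gamma> = inflection_curve R) \<longleftrightarrow>
         (\<exists>f. exact_differential f \<and> \<Gamma> = real_dessin f)"
proof
  assume "\<exists>R. nonconstant R \<and> \<Gamma> = inflection_curve R"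
  then show "\<exists>f. exact_differential f \<and> \<Gamma> = real_dessin f"
    unfolding exact_differential_iff_rat_deriv inflection_curve_def real_dessin_def by blast
next
  assume "\<exists>f. exact_differential f \<and> \<Gamma> = real_dessin f"
  \<comment> \<open>This primitive may be constant, namely when the differential is zero, so
    nonconstancy has to be arranged separately.\<close>
  then obtain R where R: "\<Gamma> = real_dessin (rat_deriv R)"
    unfolding exact_differential_iff_rat_deriv by blast
  have "\<exists>S. nonconstant S \<and> real_dessin (rat_deriv S) = real_dessin (rat_deriv R)"
  proof (cases "nonconstant R")
    case False
    \<comment> \<open>The zero function and the constant 1, which is the derivative of \<open>z\<close>, have the same dessin.\<close>
    then have "rat_deriv R = 0"
      by (auto simp: nonconstant_def rat_deriv_to_fract)
    moreover have "nonconstant (to_fract [:0, 1:])"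
      by (auto simp: nonconstant_def)
    moreover have "rat_deriv (to_fract [:0, 1:]) = 1"
      by (simp add: rat_deriv_to_fract pderiv_pCons flip: one_pCons)
    ultimately show ?thesis
      by (metis real_dessin_0 real_dessin_1)
  qed blast
  then show "\<exists>R. nonconstant R \<and> \<Gamma> = inflection_curve R"
    unfolding R by (simp add: inflection_curve_def flip: real_dessin_def) metis
qed

end
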